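(* Let $X$ be a finite set, $\alpha:X\to X$ a bijection and $E\subseteq X$ such that $(X,\alpha)$ is $E$-bound, and consider the micro-macro system $(X,[0,L],e,\alpha)$ with macrostates $X_k=e^{-1}(k)$, $k\in[0,L]$, and $X_{L+1}=\emptyset$. (a) $E=X_0$ is an equilibrium macrostate (of maximal size). $S(\alpha i)\ge S(i)$ for every $i\in X^{\mathrm{neq}}$. If $E$ is $s$-stable, then $X^{\mathrm{eq}}$ is $s$-stable. For $k\in[0,L]$, $$|[\![E,X_k]\!]|=|X_k|-|X_{k+1}|,\qquad |X_k|=\sum_{t=k}^{L}|[\![E,X_t]\!]|,$$ and the transition matrix satisfies $[\alpha]_{jk}=\delta_{j-1,k}$ for $j\ge1$ and $[\alpha]_{0k}=\frac{|X_k|-|X_{k+1}|}{|E|}$. Assume now that $e(\alpha(E))=[0,L]$. (b) $X^{\mathrm{eq}}=E$, $X^{\mathrm{neq}}=X\setminus E$, $D=\{i\in X^{\mathrm{eq}}:\alpha i\in X^{\mathrm{neq}}\}$, entropy is strictly increasing on $X^{\mathrm{neq}}$ (i.e. $S(\alpha i)>S(i)$ for $i\in X^{\mathrm{neq}}$), and $|D|=|X_1|$, $|I|=|X^{\mathrm{neq}}|$, $|C|=|X^{\mathrm{eq}}|-|X_1|$. (c) The mean (with respect to the uniform distribution on $X$) of the arrow-of-time length $\mathcal A$ is $$\langle\mathcal A\rangle=\frac{1}{|X|}\sum_{k=1}^{L}k|X_k|=\frac{|X^{\mathrm{eq}}|}{|X|}\sum_{k=1}^{L}\binom{k+1}{2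}[\alpha]_{0,k}.$$
   Context: $(X,\alpha)$ is $E$-bound if every $\alpha$-cycle meets $E$. The $E$-reaching time $e:X\to\mathbb N$ is $e(i)=$ the smallest $k\ge0$ with $\alpha^k(i)\in E$, and $L=\max_{i\in X}e(i)$. The micro-macro system $(X,[0,L],e,\alpha)$ has microstates $X$, macrostates $[0,L]=\{0,1,\dots,L\}$, micro-to-macro map $e$ and dynamics $\alpha$; the entropy of $i$ is $S(i)=\ln|e^{-1}(e(i))|$. $X^{\mathrm{eq}}$ is the set of microstates in macrostates of maximal size and $X^{\mathrm{neq}}=X\setminus X^{\mathrm{eq}}$. $D,C,I$ are the sets of $i$ with $S(\alpha i)<S(i)$, $=$, $>$ respectively. For $U,V\subseteq X$, $[\![U,V]\!]=\{i\in U:\alpha(i)\in V\}$, and $[\alpha]_{jk}=|[\![X_j,X_k]\!]|/|X_j|$. A set $F\subseteq X$ is $s$-stable (for an integer $s\ge0$) if for every $i\in F\cap\alpha(X\setminus F)$ we have $\alpha^k i\in F$ for $0\le k\le s$. For $i\in X$, $\mathcal A(i)$ is the largest integer $N\ge0$ with $S(i)<S(\alpha i)<\cdots<S(\alpha^N i)$. *)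

theory Defs
  imports "HOL-Probability.Probability" "HOL-Combinatorics.Orbits"
begin

text \<open>A micro-macro system is given by a set \<open>X\<close> of microstates, a set \<open>M\<close> of macrostates,
  a micro-to-macro map \<open>f\<close> and dynamics \<open>\<alpha>\<close>. The maps are total HOL functions of which only the
  values on \<open>X\<close> matter.\<close>

definition macrostate :: "'a set \<Rightarrow> ('a \<Rightarrow> 'b) \<Rightarrow> 'b \<Rightarrow> 'a set" where
  "macrostate X f a = {i \<in> X. f i = a}"

definition entropy_of :: "'a set \<Rightarrow> ('a \<Rightarrow> 'b) \<Rightarrow> 'a \<Rightarrow> real" where
  "entropy_of X f i = ln (real (card (macrostate X f (f i))))"

definition equilibrium_macrostate :: "'a set \<Rightarrow> 'b set \<Rightarrow> ('a \<Rightarrow> 'b) \<Rightarrow> 'b \<Rightarrow> bool" where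
  "equilibrium_macrostate X M f a \<longleftrightarrow>
     a \<in> M \<and> (\<forall>b\<in>M. card (macrostate X f b) \<le> card (macrostate X f a))"

definition eq_states :: "'a set \<Rightarrow> 'b set \<Rightarrow> ('a \<Rightarrow> 'b) \<Rightarrow> 'a set" where
  "eq_states X M f = {i \<in> X. equilibrium_macrostate X M f (f i)}"

definition neq_states :: "'a set \<Rightarrow> 'b set \<Rightarrow> ('a \<Rightarrow> 'b) \<Rightarrow> 'a set" where
  "neq_states X M f = X - eq_states X M f"

definition decreasing_states :: "'a set \<Rightarrow> ('a \<Rightarrow> 'b) \<Rightarrow> ('a \<Rightarrow> 'a) \<Rightarrow> 'a set" where
  "decreasing_states X f \<alpha> = {i \<in> X. entropy_of X f (\<alpha> i) < entropy_of X f i}"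

definition constant_states :: "'a set \<Rightarrow> ('a \<Rightarrow> 'b) \<Rightarrow> ('a \<Rightarrow> 'a) \<Rightarrow> 'a set" where
  "constant_states X f \<alpha> = {i \<in> X. entropy_of X f (\<alpha> i) = entropy_of X f i}"

definition increasing_states :: "'a set \<Rightarrow> ('a \<Rightarrow> 'b) \<Rightarrow> ('a \<Rightarrow> 'a) \<Rightarrow> 'a set" where
  "increasing_states X f \<alpha> = {i \<in> X. entropy_of X f (\<alpha> i) > entropy_of X f i}"

definition transitions :: "('a \<Rightarrow> 'a) \<Rightarrow> 'a set \<Rightarrow> 'a set \<Rightarrow> 'a set" where
  "transitions \<alpha> U V = {i \<in> U. \<alpha> i \<in> V}"

definition transition_matrix :: "'a set \<Rightarrow> ('a \<Rightarrow> 'b) \<Rightarrow> ('a \<Rightarrow> 'a) \<Rightarrow> 'b \<Rightarrow> 'b \<Rightarrow> real" where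
  "transition_matrix X f \<alpha> a b =
     real (card (transitions \<alpha> (macrostate X f a) (macrostate X f b)))
       / real (card (macrostate X f a))"

definition s_stable :: "'a set \<Rightarrow> ('a \<Rightarrow> 'a) \<Rightarrow> nat \<Rightarrow> 'a set \<Rightarrow> bool" where
  "s_stable X \<alpha> s F \<longleftrightarrow>
     F \<subseteq> X \<and> (\<forall>i \<in> F \<inter> \<alpha> ` (X - F). \<forall>k\<le>s. (\<alpha> ^^ k) i \<in> F)"

text \<open>For a permutation of a finite set the largest \<open>N\<close> below exists, since entropy cannot
  increase strictly along a whole cycle; so \<open>GREATEST\<close> is well defined.\<close>

definition arrow_length :: "'a set \<Rightarrow> ('a \<Rightarrow> 'b) \<Rightarrow> ('a \<Rightarrow> 'a) \<Rightarrow> 'a \<Rightarrow> nat" where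
  "arrow_length X f \<alpha> i =
     (GREATEST N. \<forall>n<N. entropy_of X f ((\<alpha> ^^ n) i) < entropy_of X f ((\<alpha> ^^ Suc n) i))"

definition bound_by :: "'a set \<Rightarrow> ('a \<Rightarrow> 'a) \<Rightarrow> 'a set \<Rightarrow> bool" where
  "bound_by X \<alpha> E \<longleftrightarrow> (\<forall>c \<subseteq> X. cyclic_on \<alpha> c \<longrightarrow> c \<inter> E \<noteq> {})"

definition reaching_time :: "('a \<Rightarrow> 'a) \<Rightarrow> 'a set \<Rightarrow> 'a \<Rightarrow> nat" where
  "reaching_time \<alpha> E i = (LEAST k. (\<alpha> ^^ k) i \<in> E)"

definition max_reaching_time :: "'a set \<Rightarrow> ('a \<Rightarrow> 'a) \<Rightarrow> 'a set \<Rightarrow> nat" where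
  "max_reaching_time X \<alpha> E = Max (reaching_time \<alpha> E ` X)"

text \<open>The convention \<open>X\<^bsub>L+1\<^esub> = \<emptyset>\<close> agrees with reading \<open>X\<^bsub>L+1\<^esub>\<close> as a preimage.\<close>

lemma macrostate_Suc_max_reaching_time:
  assumes "finite X"
  shows "macrostate X (reaching_time \<alpha> E) (max_reaching_time X \<alpha> E + 1) = {}"
proof -
  have "reaching_time \<alpha> E i \<le> max_reaching_time X \<alpha> E" if "i \<in> X" for i
    using assms that by (simp add: max_reaching_time_def)
  then show ?thesis
    by (fastforce simp: macrostate_def)
qed

end

theory Submission
  imports Defs
begin

text \<open>Away from \<open>E\<close> the dynamics lowers the reaching time by exactly one, so \<open>\<alpha>\<close> maps the
  disjoint union of \<open>X\<^bsub>k+1\<^esub>\<close> and \<open>\<lbrakk>E, X\<^bsub>k\<^esub>\<rbrakk>\<close> bijectively onto \<open>X\<^bsub>k\<^esub>\<close>. Hence the sizes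
  \<open>|X\<^bsub>k\<^esub>|\<close> decrease in \<open>k\<close>, strictly if \<open>\<alpha>(E)\<close> meets every macrostate, and entropy
  grows along an orbit until it reaches \<open>E\<close>. In the strict case the arrow of time from \<open>i\<close>
  therefore has length \<open>e(i)\<close>, and summation by parts gives the second formula for its mean.\<close>

text \<open>Abel summation: \<open>k\<close> is the difference of the triangular numbers
  \<open>(k + 1) choose 2\<close> and \<open>k choose 2\<close>. In the application \<open>n\<close>
  is \<open>L\<close>, and the boundary term vanishes because the macrostate at \<open>L + 1\<close>
  is empty.\<close>

lemma sum_times_index_by_parts:
  fixes a :: "nat \<Rightarrow> real"
  shows "(\<Sum>k=1..n. real k * a k) =
    (\<Sum>k=1..n. real ((k + 1) choose 2) * (a k - a (k + 1))) + real ((n + 1) choose 2) * a (n + 1)"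
proof (induction n)
  case 0
  show ?case by (simp add: choose_two)
next
  case (Suc n)
  have "real ((Suc n + 1) choose 2) = real ((n + 1) choose 2) + real (Suc n)"
    by (simp add: numeral_2_eq_2)
  with Suc show ?case by (simp add: algebra_simps)
qed

text \<open>Nonemptiness of \<open>X\<close> makes \<open>L\<close> an attained maximum and the
  uniform distribution on \<open>X\<close> meaningful.\<close>

locale E_bound_system =
  fixes X E :: "'a set" and \<alpha> :: "'a \<Rightarrow> 'a"
  assumes finite_X: "finite X" and X_nonempty: "X \<noteq> {}"
    and bij: "bij_betw \<alpha> X X"
    and E_subset: "E \<subseteq> X"
    and bound: "bound_by X \<alpha> E"
begin

abbreviation "e \<equiv> reaching_time \<alpha> E"
abbreviation "L \<equiv> max_reaching_time X \<alpha> E"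
abbreviation "Xm \<equiv> macrostate X e"
abbreviation "S \<equiv> entropy_of X e"
abbreviation "Xeq \<equiv> eq_states X {0..L} e"
abbreviation "Xneq \<equiv> neq_states X {0..L} e"

section \<open>Orbits and the countdown to \<open>E\<close>\<close>

lemma step_in: "i \<in> X \<Longrightarrow> \<alpha> i \<in> X"
  using bij by (auto simp: bij_betw_def)

lemma iterate_in: "i \<in> X \<Longrightarrow> (\<alpha> ^^ n) i \<in> X"
  by (induction n) (simp_all add: step_in)

text \<open>By pigeonhole some iterate of \<open>i\<close> recurs. Its orbit is a cycle inside
  \<open>X\<close>, and this cycle meets \<open>E\<close>.\<close>

lemma reaches_E:
  assumes i: "i \<in> X"
  shows "\<exists>k. (\<alpha> ^^ k) i \<in> E"
proof -
  have "range (\<lambda>n. (\<alpha> ^^ n) i) \<subseteq> X" using iterate_in[OF i] by auto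
  hence "\<not> inj (\<lambda>n. (\<alpha> ^^ n) i)"
    using finite_X finite_subset range_inj_infinite by blast
  then obtain m n where mn: "m < n" "(\<alpha> ^^ m) i = (\<alpha> ^^ n) i"
    unfolding inj_def by (metis nat_neq_iff)
  \<comment> \<open>The repeated iterate \<open>s\<close> lies on a cycle of length dividing
    \<open>n - m\<close>.\<close>
  define s where "s = (\<alpha> ^^ m) i"
  have "(\<alpha> ^^ (n - m)) s = (\<alpha> ^^ (n - m + m)) i"
    unfolding s_def funpow_add by simp
  hence "(\<alpha> ^^ (n - m)) s = s" using mn(1) mn(2)[symmetric] by (simp add: s_def)
  moreover have "0 < n - m" using mn(1) by simp
  ultimately have "s \<in> orbit \<alpha> s" 
    unfolding orbit_altdef by (metis (mono_tags, lifting) mem_Collect_eq)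
  hence "cyclic_on \<alpha> (orbit \<alpha> s)" by (auto simp: cyclic_on_def)
  moreover have "orbit \<alpha> s \<subseteq> X"
    using iterate_in[OF iterate_in[OF i]] unfolding orbit_altdef s_def by blast
  ultimately obtain x where "x \<in> orbit \<alpha> s" "x \<in> E"
    using bound unfolding bound_by_def by blast
  then obtain k where "(\<alpha> ^^ k) s \<in> E" unfolding orbit_altdef by blast
  hence "(\<alpha> ^^ (k + m)) i \<in> E" by (simp add: s_def funpow_add)
  thus ?thesis by blast
qed

lemma iterate_reaching_time_in_E: "i \<in> X \<Longrightarrow> (\<alpha> ^^ e i) i \<in> E"
  unfolding reaching_time_def by (rule LeastI_ex) (rule reaches_E)

lemma reaching_time_eq_0_iff:
  assumes "i \<in> X" shows "e i = 0 \<longleftrightarrow> i \<in> E"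
proof
  assume "e i = 0" with iterate_reaching_time_in_E[OF assms] show "i \<in> E" by simp
next
  assume "i \<in> E" thus "e i = 0" unfolding reaching_time_def by (intro Least_equality) auto
qed

lemma reaching_time_Suc:
  assumes "i \<in> X" "i \<notin> E" shows "e i = Suc (e (\<alpha> i))"
proof -
  have "(LEAST k. (\<alpha> ^^ k) i \<in> E) = Suc (LEAST k. (\<alpha> ^^ Suc k) i \<in> E)"
    using iterate_reaching_time_in_E[OF assms(1)] assms(2) by (intro Least_Suc) auto
  thus ?thesis unfolding reaching_time_def by (simp add: funpow_swap1)
qed

text \<open>Each step outside \<open>E\<close> lowers the reaching time by one. The bound on
  \<open>n\<close> stops the countdown at the first visit to \<open>E\<close>, after which the
  reaching time may jump.\<close>

lemma reaching_time_iterate: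
  assumes "i \<in> X" shows "n \<le> e i \<Longrightarrow> e ((\<alpha> ^^ n) i) = e i - n"
proof (induction n)
  case 0
  show ?case by simp
next
  case (Suc n)
  hence "(\<alpha> ^^ n) i \<notin> E"
    using reaching_time_eq_0_iff[OF iterate_in[OF assms, of n]] by simp
  from reaching_time_Suc[OF iterate_in[OF assms] this] Suc show ?case by simp
qed

lemma reaching_time_le: "i \<in> X \<Longrightarrow> e i \<le> L"
  using finite_X by (simp add: max_reaching_time_def)

section \<open>Sizes of macrostates\<close>

lemma finite_macrostate: "finite (Xm k)"
  using finite_X by (simp add: macrostate_def)

lemma macrostate_0: "Xm 0 = E"
  using E_subset reaching_time_eq_0_iff by (auto simp: macrostate_def)

text \<open>Sort the preimages of a state of \<open>Xm k\<close> by membership in \<open>E\<close>: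
  those outside \<open>E\<close> have reaching time \<open>Suc k\<close>.\<close>

lemma macrostate_eq_image:
  "Xm k = \<alpha> ` (Xm (Suc k) \<union> transitions \<alpha> E (Xm k))"
proof
  show "Xm k \<subseteq> \<alpha> ` (Xm (Suc k) \<union> transitions \<alpha> E (Xm k))"
  proof
    fix i assume i: "i \<in> Xm k"
    hence "i \<in> \<alpha> ` X" using bij by (simp add: macrostate_def bij_betw_def)
    then obtain j where j: "j \<in> X" "i = \<alpha> j" by blast
    show "i \<in> \<alpha> ` (Xm (Suc k) \<union> transitions \<alpha> E (Xm k))"
      using i j reaching_time_Suc[OF j(1)]
      by (cases "j \<in> E") (auto simp: transitions_def macrostate_def)
  qed
  show "\<alpha> ` (Xm (Suc k) \<union> transitions \<alpha> E (Xm k)) \<subseteq> Xm k"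
  proof -
    have "\<alpha> i \<in> Xm k" if "i \<in> Xm (Suc k)" for i
    proof -
      have "i \<in> X" "i \<notin> E" using that reaching_time_eq_0_iff[of i] by (auto simp: macrostate_def)
      with that step_in reaching_time_Suc[of i] show ?thesis by (auto simp: macrostate_def)
    qed
    thus ?thesis by (auto simp: transitions_def)
  qed
qed

text \<open>Injectivity of \<alpha> turns the previous image into a count. This identity drives
  everything below; the additive form avoids truncated subtraction.\<close>

lemma card_macrostate:
  "card (Xm k) = card (Xm (Suc k)) + card (transitions \<alpha> E (Xm k))"
proof -
  have "Xm (Suc k) \<union> transitions \<alpha> E (Xm k) \<subseteq> X"
    using E_subset by (auto simp: macrostate_def transitions_def)
  hence "inj_on \<alpha> (Xm (Suc k) \<union> transitions \<alpha> E (Xm k))"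
    using bij by (meson bij_betw_def inj_on_subset)
  hence "card (Xm k) = card (Xm (Suc k) \<union> transitions \<alpha> E (Xm k))"
    by (subst macrostate_eq_image) (rule card_image)
  also have "\<dots> = card (Xm (Suc k)) + card (transitions \<alpha> E (Xm k))"
  proof (rule card_Un_disjoint)
    show "finite (transitions \<alpha> E (Xm k))"
      using finite_subset[OF E_subset finite_X] by (simp add: transitions_def)
    \<comment> \<open>Reaching time is positive on the first set and zero on
      \<open>E\<close>.\<close>
    show "Xm (Suc k) \<inter> transitions \<alpha> E (Xm k) = {}"
      using reaching_time_eq_0_iff by (fastforce simp: transitions_def macrostate_def)
  qed (rule finite_macrostate)
  finally show ?thesis .
qed

lemma card_macrostate_antimono: "j \<le> k \<Longrightarrow> card (Xm k) \<le> card (Xm j)"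
proof (induction rule: dec_induct)
  case (step n)
  thus ?case using card_macrostate[of n] by linarith
qed simp

text \<open>The maximum \<open>L\<close> is attained, so \<open>Xm L\<close> is nonempty, and all
  lower macrostates are at least as large. Comparing logarithms and dividing by sizes rely on
  this.\<close>

lemma card_macrostate_pos:
  assumes "k \<le> L" shows "card (Xm k) > 0"
proof -
  have "L \<in> e ` X"
    unfolding max_reaching_time_def using finite_X X_nonempty by (intro Max_in) auto
  hence "Xm L \<noteq> {}" by (auto simp: macrostate_def)
  hence "card (Xm L) > 0" using finite_macrostate by (simp add: card_gt_0_iff)
  with card_macrostate_antimono[OF assms] show ?thesis by linarith
qed

section \<open>Entropy, equilibrium and stability\<close>

lemma entropy_less_iff:
  "i \<in> X \<Longrightarrow> j \<in> X \<Longrightarrow> S i < S j \<longleftrightarrow> card (Xm (e i)) < card (Xm (e j))"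
  using card_macrostate_pos[OF reaching_time_le] by (simp add: entropy_of_def)

lemma entropy_le_iff:
  "i \<in> X \<Longrightarrow> j \<in> X \<Longrightarrow> S i \<le> S j \<longleftrightarrow> card (Xm (e i)) \<le> card (Xm (e j))"
  using entropy_less_iff[of j i] by (meson not_le)

lemma equilibrium_iff:
  assumes "k \<le> L"
  shows "equilibrium_macrostate X {0..L} e k \<longleftrightarrow> card (Xm k) = card (Xm 0)"
  unfolding equilibrium_macrostate_def
  using assms card_macrostate_antimono[of 0] by (auto intro!: antisym)

lemma eq_states_iff: "i \<in> Xeq \<longleftrightarrow> i \<in> X \<and> card (Xm (e i)) = card (Xm 0)"
  unfolding eq_states_def using equilibrium_iff[OF reaching_time_le] by auto

lemma E_subset_eq_states: "E \<subseteq> Xeq"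
proof
  fix i assume "i \<in> E"
  hence "i \<in> X" "e i = 0" using E_subset reaching_time_eq_0_iff by auto
  thus "i \<in> Xeq" by (simp add: eq_states_iff)
qed

text \<open>Stated outside \<open>E\<close>, which covers \<open>Xneq\<close> because
  \<open>E\<close> is contained in \<open>Xeq\<close>.\<close>

lemma entropy_nondecreasing:
  assumes "i \<in> X" "i \<notin> E" shows "S i \<le> S (\<alpha> i)"
  using assms step_in reaching_time_Suc[OF assms] card_macrostate_antimono[of "e (\<alpha> i)" "e i"]
  by (simp add: entropy_le_iff)

text \<open>A state that has entered \<open>Xeq\<close> remains there until it reaches
  \<open>E\<close>, since the macrostates it crosses only grow. It then enters \<open>E\<close> from
  outside, so stability of \<open>E\<close> covers the remaining steps.\<close>

lemma eq_states_stable: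
  assumes "s_stable X \<alpha> s E" shows "s_stable X \<alpha> s Xeq"
  unfolding s_stable_def
proof (intro conjI ballI allI impI)
  show "Xeq \<subseteq> X" by (auto simp: eq_states_def)
  fix i n assume i: "i \<in> Xeq \<inter> \<alpha> ` (X - Xeq)" and n: "n \<le> s"
  have iX: "i \<in> X" using i by (simp add: eq_states_def)
  show "(\<alpha> ^^ n) i \<in> Xeq"
  proof (cases "n \<le> e i")
    case True
    hence "card (Xm (e i)) \<le> card (Xm (e ((\<alpha> ^^ n) i)))"
      using reaching_time_iterate[OF iX True] by (simp add: card_macrostate_antimono)
    with i iterate_in[OF iX] card_macrostate_antimono[of 0 "e ((\<alpha> ^^ n) i)"] show ?thesis
      by (auto simp: eq_states_iff)
  next
    case False
    \<comment> \<open>The orbit is followed from the predecessor \<open>j\<close> so that the step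
      into \<open>E\<close> visibly starts outside \<open>E\<close>, even when
      \<open>e i = 0\<close>.\<close>
    obtain j where j: "j \<in> X" "j \<notin> Xeq" "i = \<alpha> j" using i by blast
    hence "e j = Suc (e i)" using reaching_time_Suc E_subset_eq_states by blast
    hence "e ((\<alpha> ^^ e i) j) = 1" using reaching_time_iterate[OF j(1), of "e i"] by simp
    hence "(\<alpha> ^^ e i) j \<in> X - E"
      using reaching_time_eq_0_iff[OF iterate_in[OF j(1), of "e i"]] iterate_in[OF j(1)] by simp
    moreover have "(\<alpha> ^^ e i) i = \<alpha> ((\<alpha> ^^ e i) j)" by (simp add: j(3) funpow_swap1)
    ultimately have "(\<alpha> ^^ e i) i \<in> E \<inter> \<alpha> ` (X - E)"
      using iterate_reaching_time_in_E[OF iX] by blast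
    \<comment> \<open>Only \<open>n - e i\<close> steps remain after the entry into
      \<open>E\<close>, and this is at most \<open>s\<close>.\<close>
    hence "(\<alpha> ^^ (n - e i)) ((\<alpha> ^^ e i) i) \<in> E"
      using assms n unfolding s_stable_def by auto
    moreover have "(\<alpha> ^^ (n - e i)) ((\<alpha> ^^ e i) i) = (\<alpha> ^^ n) i"
      using False funpow_add[of "n - e i" "e i" \<alpha>] by simp
    ultimately show ?thesis using E_subset_eq_states by auto
  qed
qed

section \<open>Transition counts and weighted sums\<close>

text \<open>The counting identity telescopes downward from \<open>L\<close>, starting from the empty
  macrostate at \<open>L + 1\<close>.\<close>

lemma card_macrostate_eq_sum:
  assumes "k \<le> L"
  shows "card (Xm k) = (\<Sum>t=k..L. card (transitions \<alpha> E (Xm t)))"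
  using assms
proof (induction rule: inc_induct)
  case base
  show ?case
    using card_macrostate[of L] macrostate_Suc_max_reaching_time[OF finite_X, of \<alpha> E] by simp
next
  case (step n)
  thus ?case using card_macrostate[of n] by (simp add: sum.atLeast_Suc_atMost)
qed

lemma transition_matrix_positive_row:
  assumes "1 \<le> j" "j \<le> L"
  shows "transition_matrix X e \<alpha> j k = (if j - 1 = k then 1 else 0)"
proof -
  \<comment> \<open>Since \<open>j\<close> is at least 1, \<open>Suc (j - 1)\<close> is
    \<open>j\<close>: the whole of \<open>Xm j\<close> moves to the next lower macrostate.\<close>
  have "\<alpha> ` Xm (Suc (j - 1)) \<subseteq> Xm (j - 1)"
    using macrostate_eq_image[of "j - 1"] by blast
  hence "\<forall>i\<in>Xm j. e (\<alpha> i) = j - 1"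
    using assms by (auto simp: macrostate_def)
  hence "transitions \<alpha> (Xm j) (Xm k) = (if j - 1 = k then Xm j else {})"
    using step_in by (auto simp: transitions_def macrostate_def)
  with card_macrostate_pos[OF assms(2)] show ?thesis by (simp add: transition_matrix_def)
qed

lemma transition_matrix_zero_row:
  "transition_matrix X e \<alpha> 0 k = (real (card (Xm k)) - real (card (Xm (k + 1)))) / real (card E)"
  unfolding transition_matrix_def macrostate_0 using card_macrostate[of k] by simp

lemma sum_reaching_time: "(\<Sum>i\<in>X. real (e i)) = (\<Sum>k=1..L. real k * real (card (Xm k)))"
proof -
  have "(\<Sum>i\<in>X. real (e i)) = (\<Sum>k\<in>{0..L}. \<Sum>i\<in>{i\<in>X. e i = k}. real (e i))"
    using finite_X reaching_time_le by (intro sum.group[symmetric]) auto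
  also have "\<dots> = (\<Sum>k\<in>{0..L}. real k * real (card (Xm k)))"
    by (intro sum.cong) (auto simp: macrostate_def)
  \<comment> \<open>The term at \<open>k = 0\<close> carries the factor zero.\<close>
  also have "\<dots> = (\<Sum>k=1..L. real k * real (card (Xm k)))"
    by (simp add: sum.atLeast_Suc_atMost)
  finally show ?thesis .
qed

lemma sum_index_card_macrostate:
  "(\<Sum>k=1..L. real k * real (card (Xm k))) =
    real (card E) * (\<Sum>k=1..L. real ((k + 1) choose 2) * transition_matrix X e \<alpha> 0 k)"
proof -
  \<comment> \<open>Positivity lets the factor \<open>card E\<close> cancel the denominators of row
    0.\<close>
  have "card E > 0" using card_macrostate_pos[of 0] macrostate_0 by simp
  hence "real (card E) * (\<Sum>k=1..L. real ((k + 1) choose 2) * transition_matrix X e \<alpha> 0 k) =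
      (\<Sum>k=1..L. real ((k + 1) choose 2) * (real (card (Xm k)) - real (card (Xm (k + 1)))))"
    unfolding transition_matrix_zero_row sum_distrib_left by (intro sum.cong) auto
  with sum_times_index_by_parts[of "\<lambda>k. real (card (Xm k))" L]
    macrostate_Suc_max_reaching_time[OF finite_X, of \<alpha> E]
  show ?thesis by simp
qed

lemma entropy_le_on_E:
  assumes "i \<in> E" "j \<in> X" shows "S j \<le> S i"
proof -
  have "i \<in> X" "e i = 0" using assms E_subset reaching_time_eq_0_iff by auto
  thus ?thesis using assms(2) by (simp add: entropy_le_iff card_macrostate_antimono)
qed

lemma card_transitions_E_E: "card (transitions \<alpha> E E) + card (Xm 1) = card E"
  using card_macrostate[of 0] macrostate_0 by simp

section \<open>The strict case: \<alpha> maps \<open>E\<close> onto all macrostates\<close>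

context
  assumes onto: "e ` (\<alpha> ` E) = {0..L}"
begin

text \<open>Some state of \<open>E\<close> jumps into \<open>Xm k\<close>, so the transition term in
  \<open>card_macrostate\<close> is positive.\<close>

lemma card_macrostate_Suc_less:
  assumes "k \<le> L" shows "card (Xm (Suc k)) < card (Xm k)"
proof -
  have "k \<in> e ` (\<alpha> ` E)" using assms onto by simp
  then obtain i where "i \<in> E" "e (\<alpha> i) = k" by auto
  hence "i \<in> transitions \<alpha> E (Xm k)"
    using E_subset step_in by (auto simp: transitions_def macrostate_def)
  moreover have "finite (transitions \<alpha> E (Xm k))"
    using finite_subset[OF E_subset finite_X] by (simp add: transitions_def)
  ultimately have "card (transitions \<alpha> E (Xm k)) > 0" by (auto simp: card_gt_0_iff)
  thus ?thesis using card_macrostate[of k] by simp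
qed

lemma card_macrostate_less_zero:
  assumes "0 < k" shows "card (Xm k) < card (Xm 0)"
proof -
  have "card (Xm k) \<le> card (Xm (Suc 0))" using assms by (intro card_macrostate_antimono) simp
  with card_macrostate_Suc_less[of 0] show ?thesis by simp
qed

lemma eq_states_eq: "Xeq = E"
proof
  show "Xeq \<subseteq> E"
  proof
    fix i assume i: "i \<in> Xeq"
    hence "e i = 0" using card_macrostate_less_zero[of "e i"] by (fastforce simp: eq_states_iff)
    with i reaching_time_eq_0_iff show "i \<in> E" by (simp add: eq_states_iff)
  qed
qed (rule E_subset_eq_states)

lemma neq_states_eq: "Xneq = X - E"
  by (simp add: neq_states_def eq_states_eq)

lemma entropy_strictly_increasing:
  assumes "i \<in> X" "i \<notin> E" shows "S i < S (\<alpha> i)"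
  using assms step_in reaching_time_Suc[OF assms] reaching_time_le
    card_macrostate_Suc_less[of "e (\<alpha> i)"]
  by (simp add: entropy_less_iff)

lemma entropy_less_on_E:
  assumes "i \<in> E" "j \<in> X" shows "S j < S i \<longleftrightarrow> j \<notin> E"
proof -
  have i: "i \<in> X" "e i = 0" using assms E_subset reaching_time_eq_0_iff by auto
  show ?thesis
    using i assms(2) card_macrostate_less_zero[of "e j"] reaching_time_eq_0_iff[of j]
    by (auto simp: entropy_less_iff)
qed

text \<open>Entropy rises strictly outside \<open>E\<close>, so it can drop only on
  \<open>E\<close>, where it is maximal; there it drops exactly when the step leaves
  \<open>E\<close>.\<close>

lemma decreasing_states_eq: "decreasing_states X e \<alpha> = E - transitions \<alpha> E E"
proof -
  have "S (\<alpha> i) < S i \<longleftrightarrow> i \<in> E \<and> \<alpha> i \<notin> E" if "i \<in> X" for i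
    using that entropy_strictly_increasing[of i] entropy_less_on_E[of i "\<alpha> i"] step_in[of i]
    by (cases "i \<in> E") auto
  thus ?thesis using E_subset by (auto simp: decreasing_states_def transitions_def)
qed

lemma increasing_states_eq: "increasing_states X e \<alpha> = X - E"
proof -
  have "S i < S (\<alpha> i) \<longleftrightarrow> i \<notin> E" if "i \<in> X" for i
    using that entropy_strictly_increasing[of i] entropy_le_on_E[of i "\<alpha> i"] step_in[of i]
    by (cases "i \<in> E") auto
  thus ?thesis by (auto simp: increasing_states_def)
qed

lemma constant_states_eq: "constant_states X e \<alpha> = transitions \<alpha> E E"
proof -
  \<comment> \<open>Trichotomy of the order on the reals.\<close>
  have "constant_states X e \<alpha> = X - decreasing_states X e \<alpha> - increasing_states X e \<alpha>"
    by (auto simp: constant_states_def decreasing_states_def increasing_states_def)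
  thus ?thesis using E_subset unfolding decreasing_states_eq increasing_states_eq
    by (auto simp: transitions_def)
qed

text \<open>The case \<open>k = 0\<close> of the counting identity: as many states leave
  \<open>E\<close> as \<open>Xm 1\<close> contains.\<close>

lemma card_decreasing_states: "card (decreasing_states X e \<alpha>) = card (Xm 1)"
proof -
  have "transitions \<alpha> E E \<subseteq> E" by (auto simp: transitions_def)
  hence "card (E - transitions \<alpha> E E) = card E - card (transitions \<alpha> E E)"
    using finite_subset[OF E_subset finite_X] by (intro card_Diff_subset) (auto intro: finite_subset)
  with card_transitions_E_E show ?thesis by (simp add: decreasing_states_eq)
qed

section \<open>The arrow of time\<close>

text \<open>Entropy rises strictly up to time \<open>e i\<close>; the orbit is then in
  \<open>E\<close>, where entropy is maximal, so the next step cannot raise it.\<close>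

lemma arrow_length_eq:
  assumes "i \<in> X" shows "arrow_length X e \<alpha> i = e i"
  unfolding arrow_length_def
proof (rule Greatest_equality)
  show "\<forall>n<e i. S ((\<alpha> ^^ n) i) < S ((\<alpha> ^^ Suc n) i)"
  proof (intro allI impI)
    fix n assume "n < e i"
    hence "(\<alpha> ^^ n) i \<notin> E"
      using reaching_time_iterate[OF assms, of n] reaching_time_eq_0_iff[OF iterate_in[OF assms, of n]]
      by simp
    thus "S ((\<alpha> ^^ n) i) < S ((\<alpha> ^^ Suc n) i)"
      using entropy_strictly_increasing[OF iterate_in[OF assms]] by simp
  qed
next
  fix N assume N: "\<forall>n<N. S ((\<alpha> ^^ n) i) < S ((\<alpha> ^^ Suc n) i)"
  show "N \<le> e i"
  proof (rule ccontr)
    assume "\<not> N \<le> e i"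
    with N have "S ((\<alpha> ^^ e i) i) < S ((\<alpha> ^^ Suc (e i)) i)" by simp
    with entropy_le_on_E[OF iterate_reaching_time_in_E[OF assms] iterate_in[OF assms]]
    show False by (meson not_le)
  qed
qed

lemma mean_arrow_length:
  "measure_pmf.expectation (pmf_of_set X) (\<lambda>i. real (arrow_length X e \<alpha> i)) =
    1 / real (card X) * (\<Sum>k=1..L. real k * real (card (Xm k)))"
  using finite_X X_nonempty
  unfolding sum_reaching_time[symmetric] by (simp add: integral_pmf_of_set arrow_length_eq)

end

end

theorem theorem28:
  fixes X E :: "'a set" and \<alpha> :: "'a \<Rightarrow> 'a"
  assumes "finite X" and "X \<noteq> {}"
    and "bij_betw \<alpha> X X"
    and "E \<subseteq> X"
    and "bound_by X \<alpha> E"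
  defines "e \<equiv> reaching_time \<alpha> E"
    and "L \<equiv> max_reaching_time X \<alpha> E"
  defines "Xm \<equiv> macrostate X e"
    and "S \<equiv> entropy_of X e"
    and "Xeq \<equiv> eq_states X {0..L} e"
    and "Xneq \<equiv> neq_states X {0..L} e"
    and "T \<equiv> transition_matrix X e \<alpha>"
    and "D \<equiv> decreasing_states X e \<alpha>"
    and "C \<equiv> constant_states X e \<alpha>"
    and "I \<equiv> increasing_states X e \<alpha>"
  shows
    "(E = Xm 0 \<and> equilibrium_macrostate X {0..L} e 0
      \<and> (\<forall>i\<in>Xneq. S (\<alpha> i) \<ge> S i)
      \<and> (\<forall>s::nat. s_stable X \<alpha> s E \<longrightarrow> s_stable X \<alpha> s Xeq)
      \<and> (\<forall>k\<in>{0..L}. int (card (transitions \<alpha> E (Xm k))) = int (card (Xm k)) - int (card (Xm (k + 1))))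
      \<and> (\<forall>k\<in>{0..L}. card (Xm k) = (\<Sum>t=k..L. card (transitions \<alpha> E (Xm t))))
      \<and> (\<forall>j\<in>{1..L}. \<forall>k\<in>{0..L}. T j k = (if j - 1 = k then 1 else 0))
      \<and> (\<forall>k\<in>{0..L}. T 0 k = (real (card (Xm k)) - real (card (Xm (k + 1)))) / real (card E)))
    \<and> (e ` (\<alpha> ` E) = {0..L} \<longrightarrow>
        (Xeq = E \<and> Xneq = X - E
         \<and> D = {i \<in> Xeq. \<alpha> i \<in> Xneq}
         \<and> (\<forall>i\<in>Xneq. S (\<alpha> i) > S i)
         \<and> card D = card (Xm 1)
         \<and> card I = card Xneq
         \<and> int (card C) = int (card Xeq) - int (card (Xm 1)))
      \<and> (measure_pmf.expectation (pmf_of_set X) (\<lambda>i. real (arrow_length X e \<alpha> i))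
           = 1 / real (card X) * (\<Sum>k=1..L. real k * real (card (Xm k)))
         \<and> 1 / real (card X) * (\<Sum>k=1..L. real k * real (card (Xm k)))
           = real (card Xeq) / real (card X) * (\<Sum>k=1..L. real ((k + 1) choose 2) * T 0 k)))"
proof -
  interpret E_bound_system X E \<alpha> by unfold_locales fact+
  \<comment> \<open>These are the defining equations of the local names; unfolding them returns each
    claim to the terms of the locale.\<close>
  note defs = assms(6-)
  show ?thesis
  proof (intro conjI allI impI ballI)
    show "E = Xm 0"
      unfolding defs by (rule macrostate_0[symmetric])
    show "equilibrium_macrostate X {0..L} e 0"
      unfolding defs by (simp add: equilibrium_iff)
    show "S i \<le> S (\<alpha> i)" if "i \<in> Xneq" for i
      using that E_subset_eq_states entropy_nondecreasing unfolding defs neq_states_def by blast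
    show "s_stable X \<alpha> s Xeq" if "s_stable X \<alpha> s E" for s
      using that unfolding defs by (rule eq_states_stable)
    show "int (card (transitions \<alpha> E (Xm k))) = int (card (Xm k)) - int (card (Xm (k + 1)))" for k
      unfolding defs using card_macrostate[of k] by simp
    show "card (Xm k) = (\<Sum>t=k..L. card (transitions \<alpha> E (Xm t)))" if "k \<in> {0..L}" for k
      using that unfolding defs by (intro card_macrostate_eq_sum) simp
    show "T j k = (if j - 1 = k then 1 else 0)" if "j \<in> {1..L}" for j k
      using that unfolding defs by (intro transition_matrix_positive_row) auto
    show "T 0 k = (real (card (Xm k)) - real (card (Xm (k + 1)))) / real (card E)" for k
      unfolding defs by (rule transition_matrix_zero_row)
  next
    assume onto: "e ` (\<alpha> ` E) = {0..L}"
    note onto = onto[unfolded defs]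
    show "Xeq = E"
      unfolding defs by (rule eq_states_eq[OF onto])
    show "Xneq = X - E"
      unfolding defs by (rule neq_states_eq[OF onto])
    show "D = {i \<in> Xeq. \<alpha> i \<in> Xneq}"
      using E_subset step_in
      unfolding defs decreasing_states_eq[OF onto] eq_states_eq[OF onto] neq_states_eq[OF onto]
      by (auto simp: transitions_def)
    show "S i < S (\<alpha> i)" if "i \<in> Xneq" for i
      using that entropy_strictly_increasing[OF onto]
      unfolding defs neq_states_eq[OF onto] by blast
    show "card D = card (Xm 1)"
      unfolding defs by (rule card_decreasing_states[OF onto])
    show "card I = card Xneq"
      unfolding defs increasing_states_eq[OF onto] neq_states_eq[OF onto] ..
    \<comment> \<open>\<open>C\<close> consists of the steps from \<open>E\<close> to
      \<open>E\<close>, so this is again the counting identity at \<open>k = 0\<close>.\<close>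
    show "int (card C) = int (card Xeq) - int (card (Xm 1))"
      using card_transitions_E_E
      unfolding defs constant_states_eq[OF onto] eq_states_eq[OF onto] by linarith
    show "measure_pmf.expectation (pmf_of_set X) (\<lambda>i. real (arrow_length X e \<alpha> i))
        = 1 / real (card X) * (\<Sum>k=1..L. real k * real (card (Xm k)))"
      unfolding defs by (rule mean_arrow_length[OF onto])
    show "1 / real (card X) * (\<Sum>k=1..L. real k * real (card (Xm k)))
        = real (card Xeq) / real (card X) * (\<Sum>k=1..L. real ((k + 1) choose 2) * T 0 k)"
      unfolding defs eq_states_eq[OF onto] sum_index_card_macrostate by simp
  qed
qed

end
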